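(* Let $L$ be an $S$-Noetherian lattice, where $S$ is a multiplicatively closed subset of $L$ with $1\in S$, $0\notin S$. Then every proper element of $L$ can be written as a finite meet of $S$-primary elements.
   Context: A multiplicative lattice is a complete lattice with a commutative, associative multiplication distributing over arbitrary joins, with $1$ as identity; $L_*$ is the set of compact elements; $(a:b)=\bigvee\{x\mid xb\le a\}$. An element $m$ is principal if $a\wedge mb=m((a:m)\wedge b)$ and $a\vee(b:m)=(am\vee b):m$ for all $a,b$. An $r$-lattice is a modular, principally generated, compactly generated multiplicative lattice with $1$ compact. A multiplicatively closed subset is a nonempty $S\subseteq L_*$ closed under multiplication. An element $a$ is $S$-compact if $s a\le b\le a$ for some compact $b$ and $s\in S$; an $S$-Noetherian lattice is an $r$-lattice in which every element is $S$-compact. The radical of $a$ is $\sqrt a=\bigvee\{x\in L_*\mid x^n\le a \text{ for some } n\in\mathbb{Z}^+\}$. A proper element $q$ with $t\not\le q$ for all $t\in S$ is $S$-primary if there exists $s\in S$ such that for all $c,d\in L$, $cd\le q$ implies $sc\le q$ or $sd\le\sqrt q$.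
   Formalization: The claim is proved for proper elements a with no t in S satisfying t ≤ a; this condition is necessary, since S-primary elements lie above no element of S (e.g. a=(2) in the ideals of Z with S={(2^n)} is not such a meet). *)

theory Defs
  imports Main
begin

text \<open>Multiplicative lattices are modelled on a complete lattice type 'a with an
explicit multiplication mult. The lattice top is the element 1 and the bottom is 0.\<close>

definition mult_lattice :: "('a::complete_lattice \<Rightarrow> 'a \<Rightarrow> 'a) \<Rightarrow> bool" where
  "mult_lattice mult \<longleftrightarrow>
     (\<forall>a b. mult a b = mult b a) \<and>
     (\<forall>a b c. mult (mult a b) c = mult a (mult b c)) \<and>
     (\<forall>a X. mult a (Sup X) = Sup (mult a ` X)) \<and>
     (\<forall>a. mult top a = a)"

definition compact_el :: "'a::complete_lattice \<Rightarrow> bool" where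
  "compact_el c \<longleftrightarrow> (\<forall>X. c \<le> Sup X \<longrightarrow> (\<exists>F. finite F \<and> F \<subseteq> X \<and> c \<le> Sup F))"

definition residual :: "('a::complete_lattice \<Rightarrow> 'a \<Rightarrow> 'a) \<Rightarrow> 'a \<Rightarrow> 'a \<Rightarrow> 'a" where
  "residual mult a b = Sup {x. mult x b \<le> a}"

definition principal_el :: "('a::complete_lattice \<Rightarrow> 'a \<Rightarrow> 'a) \<Rightarrow> 'a \<Rightarrow> bool" where
  "principal_el mult m \<longleftrightarrow>
     (\<forall>a b. inf a (mult m b) = mult m (inf (residual mult a m) b)) \<and>
     (\<forall>a b. sup a (residual mult b m) = residual mult (sup (mult a m) b) m)"

definition r_lattice :: "('a::complete_lattice \<Rightarrow> 'a \<Rightarrow> 'a) \<Rightarrow> bool" where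
  "r_lattice mult \<longleftrightarrow>
     mult_lattice mult \<and>
     (\<forall>a b c::'a. a \<le> c \<longrightarrow> sup a (inf b c) = inf (sup a b) c) \<and>
     (\<forall>a::'a. \<exists>P. (\<forall>p\<in>P. principal_el mult p) \<and> a = Sup P) \<and>
     (\<forall>a::'a. \<exists>C. (\<forall>c\<in>C. compact_el c) \<and> a = Sup C) \<and>
     compact_el (top::'a)"

definition mult_closed :: "('a::complete_lattice \<Rightarrow> 'a \<Rightarrow> 'a) \<Rightarrow> 'a set \<Rightarrow> bool" where
  "mult_closed mult S \<longleftrightarrow> S \<noteq> {} \<and> (\<forall>s\<in>S. compact_el s) \<and>
     (\<forall>s\<in>S. \<forall>t\<in>S. mult s t \<in> S)"

definition S_compact :: "('a::complete_lattice \<Rightarrow> 'a \<Rightarrow> 'a) \<Rightarrow> 'a set \<Rightarrow> 'a \<Rightarrow> bool" where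
  "S_compact mult S a \<longleftrightarrow> (\<exists>s\<in>S. \<exists>b. compact_el b \<and> mult s a \<le> b \<and> b \<le> a)"

definition S_noetherian :: "('a::complete_lattice \<Rightarrow> 'a \<Rightarrow> 'a) \<Rightarrow> 'a set \<Rightarrow> bool" where
  "S_noetherian mult S \<longleftrightarrow> r_lattice mult \<and> (\<forall>a. S_compact mult S a)"

fun mpow :: "('a::complete_lattice \<Rightarrow> 'a \<Rightarrow> 'a) \<Rightarrow> 'a \<Rightarrow> nat \<Rightarrow> 'a" where
  "mpow mult x 0 = top"
| "mpow mult x (Suc n) = mult x (mpow mult x n)"

definition radical :: "('a::complete_lattice \<Rightarrow> 'a \<Rightarrow> 'a) \<Rightarrow> 'a \<Rightarrow> 'a" where
  "radical mult a = Sup {x. compact_el x \<and> (\<exists>n>0. mpow mult x n \<le> a)}"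

definition S_primary :: "('a::complete_lattice \<Rightarrow> 'a \<Rightarrow> 'a) \<Rightarrow> 'a set \<Rightarrow> 'a \<Rightarrow> bool" where
  "S_primary mult S q \<longleftrightarrow> q \<noteq> top \<and> (\<forall>t\<in>S. \<not> t \<le> q) \<and>
     (\<exists>s\<in>S. \<forall>c d. mult c d \<le> q \<longrightarrow> mult s c \<le> q \<or> mult s d \<le> radical mult q)"

end

theory Submission
  imports Defs
begin

text \<open>
  Let \<open>sat a\<close> be the join of all \<open>x\<close> with \<open>s x \<le> a\<close> for some \<open>s \<in> S\<close>. By \<open>S\<close>-compactness a single
  \<open>s\<close> satisfies \<open>s (sat a) \<le> a\<close>, and the saturated elements satisfy the ascending chain condition;
  Noether's argument then writes \<open>sat a\<close> as a finite meet of saturated primary elements \<open>q\<close>.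

  To get back to \<open>a\<close>, take \<open>w\<close> maximal with \<open>w \<and> sat a = a\<close>, and let \<open>s \<in> S\<close> multiply \<open>sat a\<close> into
  \<open>a\<close> and \<open>sat w\<close> into \<open>w\<close>. For principal \<open>x \<le> s\<close> the chain of residuals \<open>(w : x\<^sup>n)\<close> is stationary
  up to an element of \<open>S\<close>, which suffices for \<open>(w \<or> x\<^sup>n) \<and> sat a \<le> w\<close> with \<open>n\<close> large; by
  maximality \<open>x\<^sup>n \<le> w\<close>. As \<open>s\<close> is a finite join of principal elements, a power \<open>t\<close> of \<open>s\<close> lies below
  \<open>w\<close>. Hence \<open>a = sat a \<and> (a \<or> t)\<close> is the meet of the elements \<open>q \<and> (a \<or> t)\<close>, and these are
  \<open>S\<close>-primary with witness \<open>t\<close>.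
\<close>

section \<open>Compactness along chains and Zorn's lemma\<close>

lemma compact_el_le_chain:
  assumes "compact_el c" "c \<le> Sup C" "C \<noteq> {}"
    and chain: "\<And>x y. x \<in> C \<Longrightarrow> y \<in> C \<Longrightarrow> x \<le> y \<or> y \<le> x"
  shows "\<exists>x\<in>C. c \<le> x"
proof -
  obtain F where F: "finite F" "F \<subseteq> C" "c \<le> Sup F"
    using assms(1,2) unfolding compact_el_def by blast
  from F(1,2) have "\<exists>u\<in>C. \<forall>x\<in>F. x \<le> u"
  proof (induction F rule: finite_induct)
    case empty
    then show ?case using \<open>C \<noteq> {}\<close> by blast
  next
    case (insert y F)
    then obtain u where u: "u \<in> C" "\<forall>x\<in>F. x \<le> u" by blast
    show ?case
    proof (cases "y \<le> u")
      case True
      then show ?thesis using u by blast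
    next
      case False
      then have "u \<le> y" using chain[of u y] u insert.prems by blast
      then have "\<forall>x\<in>insert y F. x \<le> y" using u by (auto intro: order_trans)
      then show ?thesis using insert.prems by blast
    qed
  qed
  then obtain u where "u \<in> C" "\<forall>x\<in>F. x \<le> u" by blast
  then show ?thesis using F(3) by (meson Sup_least order_trans)
qed

text \<open>The empty chain is settled here once; later bounds come from the members of a chain or
  their join, which an empty chain cannot supply.\<close>

lemma maximal_element_exists:
  fixes A :: "'a::order set"
  assumes "A \<noteq> {}"
    and ub: "\<And>C. C \<subseteq> A \<Longrightarrow> C \<noteq> {} \<Longrightarrow> (\<And>x y. x \<in> C \<Longrightarrow> y \<in> C \<Longrightarrow> x \<le> y \<or> y \<le> x)
      \<Longrightarrow> \<exists>u\<in>A. \<forall>x\<in>C. x \<le> u"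
  shows "\<exists>m\<in>A. \<forall>x\<in>A. m \<le> x \<longrightarrow> x = m"
proof (rule predicate_Zorn)
  show "partial_order_on A (relation_of (\<le>) A)"
    by (rule partial_order_on_relation_ofI) auto
next
  fix C assume C: "C \<in> Chains (relation_of (\<le>) A)"
  show "\<exists>u\<in>A. \<forall>a\<in>C. a \<le> u"
  proof (cases "C = {}")
    case True
    then show ?thesis using \<open>A \<noteq> {}\<close> by blast
  next
    case False
    have "C \<subseteq> A" "\<And>x y. x \<in> C \<Longrightarrow> y \<in> C \<Longrightarrow> x \<le> y \<or> y \<le> x"
      using C unfolding Chains_def relation_of_def by blast+
    then show ?thesis using ub False by blast
  qed
qed

section \<open>Arithmetic of the lattice: residuals, principal elements, powers, radicals\<close>

locale S_noetherian_lattice =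
  fixes mult :: "'a::complete_lattice \<Rightarrow> 'a \<Rightarrow> 'a" (infixl "\<cdot>" 70)
    and S :: "'a set"
  assumes noetherian: "S_noetherian mult S"
    and closed: "mult_closed mult S"
    and top_in_S: "top \<in> S"
begin

abbreviation pow :: "'a \<Rightarrow> nat \<Rightarrow> 'a" where "pow \<equiv> mpow mult"

lemma r_lattice: "r_lattice mult"
  using noetherian unfolding S_noetherian_def by blast

lemma mult_lattice: "mult_lattice mult"
  using r_lattice unfolding r_lattice_def by blast

lemma mult_commute: "a \<cdot> b = b \<cdot> a"
  using mult_lattice unfolding mult_lattice_def by blast

lemma mult_assoc: "(a \<cdot> b) \<cdot> c = a \<cdot> (b \<cdot> c)"
  using mult_lattice unfolding mult_lattice_def by blast

lemma mult_left_commute: "a \<cdot> (b \<cdot> c) = b \<cdot> (a \<cdot> c)"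
  by (metis mult_assoc mult_commute)

lemmas mult_ac = mult_assoc mult_commute mult_left_commute

lemma mult_Sup: "a \<cdot> Sup X = Sup ((\<cdot>) a ` X)"
  using mult_lattice unfolding mult_lattice_def by blast

lemma top_mult [simp]: "top \<cdot> a = a"
  using mult_lattice unfolding mult_lattice_def by blast

lemma mult_top [simp]: "a \<cdot> top = a"
  by (metis mult_commute top_mult)

lemma mult_sup: "a \<cdot> sup b c = sup (a \<cdot> b) (a \<cdot> c)"
  using mult_Sup[of a "{b, c}"] by simp

lemma mult_mono_right: "b \<le> c \<Longrightarrow> a \<cdot> b \<le> a \<cdot> c"
  by (metis le_iff_sup mult_sup)

lemma mult_mono: "a \<le> b \<Longrightarrow> c \<le> d \<Longrightarrow> a \<cdot> c \<le> b \<cdot> d"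
  by (metis mult_commute mult_mono_right order_trans)

lemma mult_le_right: "a \<cdot> b \<le> b"
  using mult_mono[of a top b b] by simp

lemma mult_le_left: "a \<cdot> b \<le> a"
  using mult_le_right[of b a] by (simp add: mult_commute)

lemma mult_le_mono: "b \<le> c \<Longrightarrow> a \<cdot> b \<le> c"
  using mult_le_right order_trans by blast

lemma S_mult: "s \<in> S \<Longrightarrow> t \<in> S \<Longrightarrow> s \<cdot> t \<in> S"
  using closed unfolding mult_closed_def by blast

lemma S_compact_el: "s \<in> S \<Longrightarrow> compact_el s"
  using closed unfolding mult_closed_def by blast

lemma S_pow: "s \<in> S \<Longrightarrow> pow s n \<in> S"
  by (induction n) (auto simp: top_in_S S_mult)

lemma pow_add: "pow x (m + n) = pow x m \<cdot> pow x n"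
  by (induction m) (auto simp: mult_assoc)

lemma pow_mult_distrib: "pow (x \<cdot> y) n = pow x n \<cdot> pow y n"
  by (induction n) (auto simp: mult_ac)

lemma pow_mono: "x \<le> y \<Longrightarrow> pow x n \<le> pow y n"
  by (induction n) (auto intro: mult_mono)

lemma modular: "a \<le> c \<Longrightarrow> sup a (inf b c) = inf (sup a b) (c::'a)"
  using r_lattice unfolding r_lattice_def by blast

lemma principally_generated:
  obtains P where "\<forall>p\<in>P. principal_el mult p" "a = Sup P"
  using r_lattice unfolding r_lattice_def by metis

lemma le_if_compact_el_le:
  assumes "\<And>c. compact_el c \<Longrightarrow> c \<le> a \<Longrightarrow> c \<le> b"
  shows "a \<le> (b::'a)"
proof -
  obtain C where C: "\<forall>c\<in>C. compact_el c" "a = Sup C"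
    using r_lattice unfolding r_lattice_def by metis
  then show ?thesis using assms by (metis Sup_least Sup_upper)
qed

lemma compact_el_finite_Sup_principal:
  assumes "compact_el c"
  obtains F where "finite F" "\<forall>p\<in>F. principal_el mult p" "c = Sup F"
proof -
  obtain P where P: "\<forall>p\<in>P. principal_el mult p" "c = Sup P"
    using principally_generated .
  obtain F where "finite F" "F \<subseteq> P" "c \<le> Sup F"
    using assms P(2) unfolding compact_el_def by blast
  then show ?thesis using that[of F] P by (metis Sup_subset_mono order_antisym subsetD)
qed

lemma le_residual_iff: "r \<le> residual mult a b \<longleftrightarrow> r \<cdot> b \<le> a"
proof
  assume "r \<le> residual mult a b"
  then have "b \<cdot> r \<le> b \<cdot> Sup {x. x \<cdot> b \<le> a}"
    unfolding residual_def by (rule mult_mono_right)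
  also have "\<dots> \<le> a" by (auto simp: mult_Sup mult_commute intro!: Sup_least)
  finally show "r \<cdot> b \<le> a" by (simp add: mult_commute)
next
  assume "r \<cdot> b \<le> a"
  then show "r \<le> residual mult a b" unfolding residual_def by (simp add: Sup_upper)
qed

text \<open>The meet identity of a principal \<open>x\<close> makes everything below
  \<open>x\<close> a multiple of \<open>x\<close>. Its cofactor for \<open>y\<close> is again below
  \<open>pow x n\<close>, so one factor is split off at a time.\<close>

lemma le_principal_pow:
  assumes x: "principal_el mult x" and "y \<le> pow x n"
  shows "\<exists>r. y = pow x n \<cdot> r"
  using assms(2)
proof (induction n arbitrary: y)
  case 0
  then show ?case by simp
next
  case (Suc n)
  have "y = inf y (x \<cdot> pow x n)" using Suc.prems by (simp add: inf_absorb1)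
  also have "\<dots> = x \<cdot> inf (residual mult y x) (pow x n)"
    using x unfolding principal_el_def by blast
  finally have y: "y = x \<cdot> inf (residual mult y x) (pow x n)" .
  obtain r where "inf (residual mult y x) (pow x n) = pow x n \<cdot> r"
    using Suc.IH[OF inf_le2] by blast
  then have "y = pow x (Suc n) \<cdot> r" using y by (simp add: mult_assoc)
  then show ?case by blast
qed

text \<open>Modularity lets the previous lemma work modulo \<open>q\<close>: this stands in for
  writing an element of a sum of ideals as a sum of elements.\<close>

lemma sup_principal_pow:
  assumes "principal_el mult x" "z \<le> sup q (pow x n)"
  obtains r where "sup q z = sup q (pow x n \<cdot> r)"
proof -
  have "sup q (inf (pow x n) (sup q z)) = inf (sup q (pow x n)) (sup q z)"
    by (rule modular) simp
  also have "\<dots> = sup q z" using assms(2) by (simp add: inf_absorb2)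
  finally show ?thesis
    using le_principal_pow[OF assms(1) inf_le1, of n "sup q z"] that by metis
qed

text \<open>As in the binomial theorem, a product of \<open>m + n\<close> factors contains
  \<open>m\<close> times \<open>x\<close> or \<open>n\<close> times \<open>y\<close>. The induction
  splits off one factor; if an exponent is 0, the right side is \<open>top\<close>.\<close>

lemma pow_sup_le: "pow (sup x y) (m + n) \<le> sup (pow x m) (pow y n)"
proof (induction "m + n" arbitrary: m n)
  case 0
  then show ?case by simp
next
  case (Suc k)
  show ?case
  proof (cases "m = 0 \<or> n = 0")
    case True
    then show ?thesis by auto
  next
    case False
    then obtain i j where ij: "m = Suc i" "n = Suc j" by (metis not0_implies_Suc)
    have k: "k = i + n" "k = m + j" using Suc.hyps(2) ij by auto
    have "x \<cdot> pow (sup x y) k \<le> x \<cdot> sup (pow x i) (pow y n)"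
      using Suc.hyps(1)[OF k(1)] k(1) by (simp add: mult_mono_right)
    also have "\<dots> \<le> sup (pow x m) (pow y n)"
      unfolding mult_sup ij(1) mpow.simps by (rule sup_mono[OF order_refl mult_le_right])
    finally have 1: "x \<cdot> pow (sup x y) k \<le> sup (pow x m) (pow y n)" .
    have "y \<cdot> pow (sup x y) k \<le> y \<cdot> sup (pow x m) (pow y j)"
      using Suc.hyps(1)[OF k(2)] k(2) by (simp add: mult_mono_right)
    also have "\<dots> \<le> sup (pow x m) (pow y n)"
      unfolding mult_sup ij(2) mpow.simps by (rule sup_mono[OF mult_le_right order_refl])
    finally have 2: "y \<cdot> pow (sup x y) k \<le> sup (pow x m) (pow y n)" .
    have "pow (sup x y) (m + n) = sup x y \<cdot> pow (sup x y) k"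
      by (simp add: Suc.hyps(2)[symmetric])
    also have "\<dots> = sup (x \<cdot> pow (sup x y) k) (y \<cdot> pow (sup x y) k)"
      by (metis mult_commute mult_sup)
    finally show ?thesis using 1 2 by simp
  qed
qed

lemma pow_Sup_le:
  assumes "finite F" "\<And>x. x \<in> F \<Longrightarrow> \<exists>n. pow x n \<le> q"
  shows "\<exists>n. pow (Sup F) n \<le> q"
  using assms
proof (induction F rule: finite_induct)
  case empty
  \<comment> \<open>Exponent 0 would give \<open>top\<close>; the first power gives
    \<open>bot\<close>.\<close>
  have "pow (Sup {}) 1 \<le> q" by simp
  then show ?case by blast
next
  case (insert x F)
  then obtain m n where "pow x m \<le> q" "pow (Sup F) n \<le> q" by blast
  then have "pow (sup x (Sup F)) (m + n) \<le> q"
    using pow_sup_le[of x "Sup F" m n] by (meson le_sup_iff order_trans sup_least)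
  then show ?case by auto
qed

lemma le_radical:
  assumes "pow z n \<le> a"
  shows "z \<le> radical mult a"
proof (rule le_if_compact_el_le)
  fix c assume c: "compact_el c" "c \<le> z"
  \<comment> \<open>\<open>radical\<close> asks for a positive exponent, and \<open>n\<close> may be
    0.\<close>
  have "pow c (Suc n) \<le> pow c n" by (simp add: mult_le_right)
  then have "pow c (Suc n) \<le> a" using pow_mono[OF c(2)] assms by (meson order_trans)
  then show "c \<le> radical mult a"
    unfolding radical_def using c(1) by (intro Sup_upper) blast
qed

section \<open>Saturation with respect to \<open>S\<close>, and chains stationary up to
  \<open>S\<close>\<close>

text \<open>For ideals of a ring this is the contraction of the localization of \<open>a\<close> at
  \<open>S\<close>.\<close>

definition sat :: "'a \<Rightarrow> 'a" where
  "sat a = Sup {x. \<exists>s\<in>S. s \<cdot> x \<le> a}"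

lemma common_S_multiple:
  assumes "finite F" "\<And>x. x \<in> F \<Longrightarrow> \<exists>s\<in>S. s \<cdot> x \<le> a"
  shows "\<exists>s\<in>S. s \<cdot> Sup F \<le> a"
  using assms
proof (induction F rule: finite_induct)
  case empty
  have "top \<cdot> Sup {} \<le> a" by simp
  then show ?case using top_in_S by blast
next
  case (insert x F)
  then obtain s t where st: "s \<in> S" "s \<cdot> x \<le> a" "t \<in> S" "t \<cdot> Sup F \<le> a" by blast
  have "t \<cdot> (s \<cdot> x) \<le> a" "s \<cdot> (t \<cdot> Sup F) \<le> a" using st by (auto intro: mult_le_mono)
  then have "(s \<cdot> t) \<cdot> Sup (insert x F) \<le> a" by (simp add: mult_sup mult_ac)
  then show ?case using S_mult st by blast
qed

text \<open>\<open>S\<close>-compactness of \<open>sat a\<close> traps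
  \<open>t \<cdot> sat a\<close> below a compact \<open>b\<close>. Finitely many of the joined
  elements already cover \<open>b\<close>, and these share a multiplier.\<close>

lemma S_mult_sat_le: "\<exists>s\<in>S. s \<cdot> sat a \<le> a"
proof -
  obtain t b where t: "t \<in> S" "compact_el b" "t \<cdot> sat a \<le> b" "b \<le> sat a"
    using noetherian unfolding S_noetherian_def S_compact_def by blast
  then obtain F where F: "finite F" "F \<subseteq> {x. \<exists>s\<in>S. s \<cdot> x \<le> a}" "b \<le> Sup F"
    unfolding compact_el_def sat_def by blast
  then obtain s where s: "s \<in> S" "s \<cdot> Sup F \<le> a" using common_S_multiple[of F a] by blast
  have "s \<cdot> (t \<cdot> sat a) \<le> s \<cdot> Sup F" using t F by (meson mult_mono_right order_trans)
  then have "(s \<cdot> t) \<cdot> sat a \<le> a" using s by (simp add: mult_assoc)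
  then show ?thesis using S_mult s t by blast
qed

lemma le_sat_iff: "x \<le> sat a \<longleftrightarrow> (\<exists>s\<in>S. s \<cdot> x \<le> a)"
proof
  assume "x \<le> sat a"
  then show "\<exists>s\<in>S. s \<cdot> x \<le> a" using S_mult_sat_le by (meson mult_mono_right order_trans)
next
  assume "\<exists>s\<in>S. s \<cdot> x \<le> a"
  then show "x \<le> sat a" unfolding sat_def by (simp add: Sup_upper)
qed

lemma le_sat: "a \<le> sat a"
  using le_sat_iff top_in_S by (metis order_refl top_mult)

lemma sat_sat: "sat (sat a) = sat a"
proof (rule order_antisym)
  obtain s where s: "s \<in> S" "s \<cdot> sat (sat a) \<le> sat a" using S_mult_sat_le by blast
  then obtain t where "t \<in> S" "t \<cdot> (s \<cdot> sat (sat a)) \<le> a" using le_sat_iff by blast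
  then have "(t \<cdot> s) \<cdot> sat (sat a) \<le> a" by (simp add: mult_assoc)
  then show "sat (sat a) \<le> sat a" using le_sat_iff S_mult s \<open>t \<in> S\<close> by blast
qed (rule le_sat)

text \<open>A substitute for the ascending chain condition: the compact element supplied by
  \<open>S\<close>-compactness of \<open>Sup C\<close> already lies below a member of the
  chain.\<close>

lemma S_stationary_chain:
  assumes "C \<noteq> {}" "\<And>x y. x \<in> C \<Longrightarrow> y \<in> C \<Longrightarrow> x \<le> y \<or> y \<le> x"
  shows "\<exists>t\<in>S. \<exists>c\<in>C. t \<cdot> Sup C \<le> c"
proof -
  obtain t b where t: "t \<in> S" "compact_el b" "t \<cdot> Sup C \<le> b" "b \<le> Sup C"
    using noetherian unfolding S_noetherian_def S_compact_def by blast
  then show ?thesis using compact_el_le_chain[OF t(2,4) assms] by (meson order_trans)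
qed

text \<open>The residuals of \<open>q\<close> by \<open>pow x n\<close> increase with
  \<open>n\<close>, so some \<open>t\<close> in \<open>S\<close> carries their join below the
  \<open>n\<close>-th one. Passing to \<open>sat q\<close> absorbs \<open>t\<close>, and
  \<open>n\<close> is uniform in \<open>m\<close> and \<open>r\<close>.\<close>

lemma S_stationary_residuals:
  "\<exists>n. \<forall>m r. pow x m \<cdot> r \<le> q \<longrightarrow> pow x n \<cdot> r \<le> sat q"
proof -
  let ?K = "\<lambda>n. residual mult q (pow x n)"
  have mono: "?K m \<le> ?K n" if "m \<le> n" for m n
  proof -
    have "?K m \<cdot> pow x n = pow x (n - m) \<cdot> (?K m \<cdot> pow x m)"
      using pow_add[of x "n - m" m] that by (simp add: mult_ac)
    also have "\<dots> \<le> q" using le_residual_iff by (blast intro: mult_le_mono)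
    finally show ?thesis by (simp add: le_residual_iff)
  qed
  obtain t n where t: "t \<in> S" "t \<cdot> Sup (range ?K) \<le> ?K n"
  proof -
    have "\<exists>t\<in>S. \<exists>c\<in>range ?K. t \<cdot> Sup (range ?K) \<le> c"
      using mono nat_le_linear by (intro S_stationary_chain) blast+
    then show ?thesis using that by blast
  qed
  have "pow x n \<cdot> r \<le> sat q" if "pow x m \<cdot> r \<le> q" for m r
  proof -
    have "r \<le> ?K m" using that by (simp add: le_residual_iff mult_commute)
    then have "t \<cdot> r \<le> ?K n" using t(2)
      by (meson SUP_upper2 UNIV_I mult_mono_right order_trans)
    then have "t \<cdot> (pow x n \<cdot> r) \<le> q" by (simp add: le_residual_iff mult_ac)
    then show ?thesis using le_sat_iff t(1) by blast
  qed
  then show ?thesis by blast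
qed

section \<open>Primary decomposition of saturated elements\<close>

text \<open>Noether's proof that irreducible implies primary, kept inside the saturated elements.
  Some principal \<open>x\<close> below \<open>d\<close> escapes the radical, and its powers split
  \<open>q\<close>.\<close>

lemma saturated_not_primary_reducible:
  assumes q: "sat q = q" and cd: "c \<cdot> d \<le> q" "\<not> c \<le> q" "\<not> d \<le> radical mult q"
  shows "\<exists>u v. sat u = u \<and> sat v = v \<and> q < u \<and> q < v \<and> q = inf u v"
proof -
  obtain P where P: "\<forall>p\<in>P. principal_el mult p" "d = Sup P"
    using principally_generated .
  then obtain x where x: "x \<in> P" "\<not> x \<le> radical mult q"
    using cd(3) by (metis Sup_least)
  have px: "principal_el mult x" using P x by blast
  have "x \<le> d" using P x by (simp add: Sup_upper)
  then have cx: "c \<cdot> x \<le> q" using cd(1) by (meson mult_mono_right order_trans)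
  obtain n where n: "\<And>m r. pow x m \<cdot> r \<le> q \<Longrightarrow> pow x n \<cdot> r \<le> q"
    using S_stationary_residuals[of x q] q by auto
  define u where "u = residual mult q (pow x n)"
  \<comment> \<open>The join of \<open>q\<close> and \<open>pow x n\<close> need not be saturated,
    unlike the residual \<open>u\<close>.\<close>
  define v where "v = sat (sup q (pow x n))"
  have "sat u \<le> u"
  proof -
    obtain s where s: "s \<in> S" "s \<cdot> sat u \<le> u" using S_mult_sat_le by blast
    then have "s \<cdot> (sat u \<cdot> pow x n) \<le> q" by (simp add: u_def le_residual_iff mult_assoc)
    then have "sat u \<cdot> pow x n \<le> q" using s q le_sat_iff by metis
    then show ?thesis unfolding u_def by (simp add: le_residual_iff)
  qed
  then have su: "sat u = u" using le_sat by (simp add: order_antisym)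
  have sv: "sat v = v" by (simp add: v_def sat_sat)
  have "c \<le> u"
    using n[of 1 c] cx by (simp add: u_def le_residual_iff mult_commute)
  moreover have qu: "q \<le> u" by (simp add: u_def le_residual_iff mult_le_left)
  ultimately have "q < u" using cd(2) by (metis order_le_less)
  have qv: "q \<le> v" "pow x n \<le> v" using le_sat[of "sup q (pow x n)"] by (auto simp: v_def)
  moreover have "\<not> pow x n \<le> q" using le_radical x(2) by blast
  ultimately have "q < v" by (metis order_le_less)
  have "inf u v \<le> q"
  proof -
    have "inf u v \<le> sat (sup q (pow x n))" by (simp add: v_def)
    then obtain s where s: "s \<in> S" "s \<cdot> inf u v \<le> sup q (pow x n)" using le_sat_iff by blast
    let ?z = "s \<cdot> inf u v"
    \<comment> \<open>Modulo \<open>q\<close>, \<open>?z\<close> is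
      \<open>pow x n \<cdot> r\<close>. Lying below \<open>u\<close>, it is sent below
      \<open>q\<close> by \<open>pow x n\<close>, and the choice of \<open>n\<close> lowers the
      exponent \<open>n + n\<close> back to \<open>n\<close>.\<close>
    obtain r where r: "sup q ?z = sup q (pow x n \<cdot> r)" using sup_principal_pow[OF px s(2)] .
    have "?z \<le> u" by (simp add: mult_le_mono)
    then have "pow x n \<cdot> ?z \<le> q" by (simp add: u_def le_residual_iff mult_commute)
    then have "pow x n \<cdot> sup q ?z \<le> q" by (simp add: mult_sup mult_le_right)
    then have "pow x n \<cdot> (pow x n \<cdot> r) \<le> q" by (simp add: r mult_sup)
    then have "pow x n \<cdot> r \<le> q" using n[of "n + n" r] by (simp add: pow_add mult_assoc)
    then have "sup q ?z \<le> q" by (simp add: r)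
    then have "?z \<le> q" by simp
    then show ?thesis using s(1) q le_sat_iff by metis
  qed
  then have "q = inf u v" using qu qv by (simp add: order_antisym)
  then show ?thesis using su sv \<open>q < u\<close> \<open>q < v\<close> by blast
qed

text \<open>Being saturated and proper keeps every \<open>s\<close> in \<open>S\<close> from lying
  below \<open>q\<close>, since \<open>s \<cdot> top \<le> q\<close> would give
  \<open>top \<le> q\<close>.\<close>

definition saturated_primary :: "'a \<Rightarrow> bool" where
  "saturated_primary q \<longleftrightarrow> q \<noteq> top \<and> sat q = q \<and>
     (\<forall>c d. c \<cdot> d \<le> q \<longrightarrow> c \<le> q \<or> d \<le> radical mult q)"

lemma saturated_primary_decomposition:
  assumes "sat a = a" "a \<noteq> top"
  shows "\<exists>Q. finite Q \<and> Q \<noteq> {} \<and> (\<forall>q\<in>Q. saturated_primary q) \<and> a = Inf Q"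
proof (rule ccontr)
  define dec where "dec b \<longleftrightarrow> (\<exists>Q. finite Q \<and> Q \<noteq> {} \<and> (\<forall>q\<in>Q. saturated_primary q) \<and> b = Inf Q)"
    for b
  define N where "N = {b. sat b = b \<and> b \<noteq> top \<and> \<not> dec b}"
  assume "\<not> ?thesis"
  then have "N \<noteq> {}" using assms unfolding N_def dec_def by blast
  then have "\<exists>m\<in>N. \<forall>x\<in>N. m \<le> x \<longrightarrow> x = m"
  proof (rule maximal_element_exists)
    fix C assume C: "C \<subseteq> N" "C \<noteq> {}" "\<And>x y. x \<in> C \<Longrightarrow> y \<in> C \<Longrightarrow> x \<le> y \<or> y \<le> x"
    then obtain t c where t: "t \<in> S" "c \<in> C" "t \<cdot> Sup C \<le> c"
      using S_stationary_chain[of C] by blast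
    \<comment> \<open>Being stationary up to \<open>t\<close> is enough: the saturated
      \<open>c\<close> absorbs \<open>t\<close> and so bounds the whole chain.\<close>
    then have "Sup C \<le> sat c" using le_sat_iff by blast
    then have "Sup C \<le> c" using t(2) C(1) unfolding N_def by auto
    then show "\<exists>u\<in>N. \<forall>x\<in>C. x \<le> u" using t(2) C(1) by (meson Sup_upper order_trans subsetD)
  qed
  then obtain m where m: "m \<in> N" and max: "\<And>x. x \<in> N \<Longrightarrow> m \<le> x \<Longrightarrow> x = m" by blast
  have "\<not> saturated_primary m"
  proof
    assume "saturated_primary m"
    then have "dec m" unfolding dec_def by (intro exI[of _ "{m}"]) auto
    then show False using m unfolding N_def by blast
  qed
  then obtain c d where "c \<cdot> d \<le> m" "\<not> c \<le> m" "\<not> d \<le> radical mult m"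
    using m unfolding saturated_primary_def N_def by blast
  then obtain u v where uv: "sat u = u" "sat v = v" "m < u" "m < v" "m = inf u v"
    using saturated_not_primary_reducible[of m c d] m unfolding N_def by blast
  then have "u \<noteq> top" "v \<noteq> top" by auto
  then have "dec u" "dec v" using uv(1-4) max[of u] max[of v] less_imp_le less_irrefl unfolding N_def by blast+
  then obtain U V where "finite U" "U \<noteq> {}" "\<forall>q\<in>U. saturated_primary q" "u = Inf U"
    "finite V" "V \<noteq> {}" "\<forall>q\<in>V. saturated_primary q" "v = Inf V"
    unfolding dec_def by blast
  then have "dec m" unfolding dec_def using uv(5)
    by (intro exI[of _ "U \<union> V"]) (auto simp: Inf_union_distrib)
  then show False using m unfolding N_def by blast
qed

section \<open>From the saturation back to \<open>a\<close>\<close>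

text \<open>In ring terms: modulo \<open>a\<close>, the ideal generated by a suitable
  \<open>t\<close> in \<open>S\<close> meets the \<open>S\<close>-torsion trivially.\<close>

lemma S_torsion_complement: "\<exists>t\<in>S. inf (sup a t) (sat a) = a"
proof -
  let ?J = "sat a"
  define N where "N = {w. a \<le> w \<and> inf w ?J \<le> a}"
  have "N \<noteq> {}" unfolding N_def using inf_le1 by blast
  then have "\<exists>m\<in>N. \<forall>x\<in>N. m \<le> x \<longrightarrow> x = m"
  proof (rule maximal_element_exists)
    fix C assume C: "C \<subseteq> N" "C \<noteq> {}" "\<And>x y. x \<in> C \<Longrightarrow> y \<in> C \<Longrightarrow> x \<le> y \<or> y \<le> x"
    \<comment> \<open>In a compactly generated lattice meets commute with joins of chains, so the
      join of the chain stays in \<open>N\<close>.\<close>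
    have "inf (Sup C) ?J \<le> a"
    proof (rule le_if_compact_el_le)
      fix c assume c: "compact_el c" "c \<le> inf (Sup C) ?J"
      then obtain x where "x \<in> C" "c \<le> x" using compact_el_le_chain[of c C] C by auto
      then show "c \<le> a" using c C(1) unfolding N_def
        by (metis (no_types, lifting) le_inf_iff mem_Collect_eq order_trans subsetD)
    qed
    moreover have "a \<le> Sup C" using C(1,2) unfolding N_def
      by (metis (no_types, lifting) Sup_upper2 ex_in_conv mem_Collect_eq subsetD)
    ultimately show "\<exists>u\<in>N. \<forall>x\<in>C. x \<le> u" unfolding N_def
      by (intro bexI[of _ "Sup C"]) (auto simp: Sup_upper)
  qed
  then obtain w where w: "a \<le> w" "inf w ?J \<le> a"
    and max: "\<And>x. a \<le> x \<Longrightarrow> inf x ?J \<le> a \<Longrightarrow> w \<le> x \<Longrightarrow> x = w"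
    unfolding N_def by blast
  obtain s1 where s1: "s1 \<in> S" "s1 \<cdot> ?J \<le> a" using S_mult_sat_le by blast
  obtain s2 where s2: "s2 \<in> S" "s2 \<cdot> sat w \<le> w" using S_mult_sat_le by blast
  define s where "s = s1 \<cdot> s2"
  have sS: "s \<in> S" unfolding s_def using s1 s2 S_mult by blast
  have nilpotent: "\<exists>n. pow x n \<le> w" if x: "principal_el mult x" "x \<le> s" for x
  proof -
    have "x \<le> s1" "x \<le> s2" using x(2) mult_le_left mult_le_right unfolding s_def
      by (blast intro: order_trans)+
    then have xJ: "x \<cdot> ?J \<le> w" and xw: "x \<cdot> sat w \<le> w"
      using s1 s2 w(1) by (meson mult_mono order_refl order_trans)+
    obtain n where n: "\<And>m r. pow x m \<cdot> r \<le> w \<Longrightarrow> pow x n \<cdot> r \<le> sat w"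
      using S_stationary_residuals[of x w] by blast
    \<comment> \<open>\<open>x \<le> s1\<close> gives \<open>x \<cdot> ?e \<le> w\<close>, and the
      choice of \<open>n\<close> then puts \<open>pow x n \<cdot> r\<close> below
      \<open>sat w\<close>. Returning to \<open>w\<close> by \<open>x \<le> s2\<close> costs one
      more factor \<open>x\<close>, hence \<open>Suc n\<close>.\<close>
    let ?w = "sup w (pow x (Suc n))"
    let ?e = "inf ?w ?J"
    obtain r where r: "sup w ?e = sup w (pow x (Suc n) \<cdot> r)"
      using sup_principal_pow[OF x(1) inf_le1] .
    have "x \<cdot> ?e \<le> w" using xJ by (meson inf_le2 mult_mono_right order_trans)
    then have "x \<cdot> sup w ?e \<le> w" by (simp add: mult_sup mult_le_right)
    then have "x \<cdot> (pow x (Suc n) \<cdot> r) \<le> w" unfolding r by (simp add: mult_sup)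
    then have "pow x (Suc (Suc n)) \<cdot> r \<le> w" by (simp add: mult_assoc)
    then have "x \<cdot> (pow x n \<cdot> r) \<le> w" using n xw by (meson mult_mono_right order_trans)
    then have "sup w ?e \<le> w" unfolding r by (simp add: mult_assoc)
    then have "?e \<le> w" by simp
    then have "?e \<le> a" using w(2) by (meson inf_le2 le_inf_iff order_trans)
    then have "?w = w" by (intro max) (auto intro: le_supI1 w(1))
    then show ?thesis by (metis sup_ge2)
  qed
  obtain F where F: "finite F" "\<forall>p\<in>F. principal_el mult p" "s = Sup F"
    using compact_el_finite_Sup_principal[OF S_compact_el[OF sS]] .
  have "\<exists>n. pow (Sup F) n \<le> w"
    using F by (intro pow_Sup_le nilpotent) (auto simp: Sup_upper)
  then obtain n where "pow s n \<le> w" using F(3) by blast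
  then have "inf (sup a (pow s n)) ?J \<le> a"
    using w by (meson inf_mono order_refl order_trans sup_least)
  then have "inf (sup a (pow s n)) ?J = a" by (intro order_antisym) (auto intro: le_sat)
  then show ?thesis using S_pow[OF sS] by blast
qed

text \<open>Multiplication by \<open>t\<close> moves every element below \<open>b\<close>, so the
  alternative that holds for \<open>q\<close> passes to the meet with \<open>t\<close> as the
  uniform witness.\<close>

lemma S_primary_inf:
  assumes q: "saturated_primary q" and t: "t \<in> S" "t \<le> b"
  shows "S_primary mult S (inf q b)"
  unfolding S_primary_def
proof (intro conjI ballI)
  have top: "q \<noteq> top" "sat q = q" and
    prim: "\<And>c d. c \<cdot> d \<le> q \<Longrightarrow> c \<le> q \<or> d \<le> radical mult q"
    using q unfolding saturated_primary_def by auto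
  have disj: "\<not> s \<le> q" if "s \<in> S" for s
  proof
    assume "s \<le> q"
    then have "s \<cdot> top \<le> q" by simp
    then have "top \<le> q" using le_sat_iff[of top q] that top(2) by auto
    then show False using top(1) by (simp add: top_le)
  qed
  then show "\<not> s \<le> inf q b" if "s \<in> S" for s using that by simp
  show "inf q b \<noteq> top" using top(1) by (metis inf_eq_top_iff)
  have rad: "t \<cdot> radical mult q \<le> radical mult (inf q b)"
    unfolding radical_def[of mult q] mult_Sup
  proof (rule Sup_least)
    fix y assume "y \<in> (\<cdot>) t ` {x. compact_el x \<and> (\<exists>n>0. pow x n \<le> q)}"
    then obtain x n where y: "y = t \<cdot> x" "n > 0" "pow x n \<le> q" by blast
    \<comment> \<open>Here the positive exponent in \<open>radical\<close> matters: one factor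
      \<open>t\<close> must survive to stay below \<open>b\<close>.\<close>
    have "pow t n \<le> t" using y(2) by (cases n) (auto simp: mult_le_left)
    then have "pow y n \<le> t \<cdot> q" unfolding y pow_mult_distrib using y(3) by (rule mult_mono)
    also have "\<dots> \<le> inf q b" using t(2) by (meson le_inf_iff mult_le_left mult_le_right order_trans)
    finally show "y \<le> radical mult (inf q b)" by (rule le_radical)
  qed
  show "\<exists>s\<in>S. \<forall>c d. c \<cdot> d \<le> inf q b \<longrightarrow> s \<cdot> c \<le> inf q b \<or> s \<cdot> d \<le> radical mult (inf q b)"
  proof (intro bexI[OF _ t(1)] allI impI)
    fix c d assume "c \<cdot> d \<le> inf q b"
    then have "c \<le> q \<or> d \<le> radical mult q" using prim by simp
    then show "t \<cdot> c \<le> inf q b \<or> t \<cdot> d \<le> radical mult (inf q b)"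
    proof
      assume "c \<le> q"
      then have "t \<cdot> c \<le> inf q b" using t(2) mult_le_left[of t c] mult_le_mono
        by (meson le_inf_iff order_trans)
      then show ?thesis ..
    next
      assume "d \<le> radical mult q"
      then have "t \<cdot> d \<le> radical mult (inf q b)" using rad by (meson mult_mono_right order_trans)
      then show ?thesis ..
    qed
  qed
qed

text \<open>The hypothesis on \<open>a\<close> is forced: an element of \<open>S\<close> below
  \<open>a\<close> would lie below each component in \<open>Q\<close>. It makes \<open>sat a\<close>
  proper, since \<open>s \<cdot> top = s\<close>.\<close>

lemma S_primary_decomposition:
  assumes a: "\<forall>t\<in>S. \<not> t \<le> a"
  shows "\<exists>Q. finite Q \<and> Q \<noteq> {} \<and> (\<forall>q\<in>Q. S_primary mult S q) \<and> a = Inf Q"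
proof -
  have "sat a \<noteq> top" using S_mult_sat_le[of a] a by auto
  then obtain Q where Q: "finite Q" "Q \<noteq> {}" "\<forall>q\<in>Q. saturated_primary q" "sat a = Inf Q"
    using saturated_primary_decomposition[OF sat_sat] by blast
  obtain t where t: "t \<in> S" "inf (sup a t) (sat a) = a" using S_torsion_complement by blast
  let ?Q = "(\<lambda>q. inf q (sup a t)) ` Q"
  \<comment> \<open>A constant meet can be pulled out of \<open>Inf\<close> because \<open>Q\<close>
    is nonempty.\<close>
  have "Inf ?Q = inf (sat a) (sup a t)"
    using Q(2) unfolding Q(4) by (simp add: INF_inf_const2)
  also have "\<dots> = a" using t(2) by (simp add: inf_commute)
  finally have "a = Inf ?Q" by simp
  moreover have "\<forall>q\<in>?Q. S_primary mult S q" using Q(3) t(1) S_primary_inf by auto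
  ultimately show ?thesis using Q(1,2) by (intro exI[of _ ?Q]) auto
qed

end

theorem mainTheorem4:
  fixes mult :: "'a::complete_lattice \<Rightarrow> 'a \<Rightarrow> 'a" and S :: "'a set" and a :: 'a
  assumes "S_noetherian mult S"
    and "mult_closed mult S"
    and "top \<in> S" and "bot \<notin> S"
    and "a \<noteq> top"
    and "\<forall>t\<in>S. \<not> t \<le> a"
  shows "\<exists>Q. finite Q \<and> Q \<noteq> {} \<and> (\<forall>q\<in>Q. S_primary mult S q) \<and> a = Inf Q"
proof -
  interpret S_noetherian_lattice mult S
    using assms(1-3) by unfold_locales
  show ?thesis using assms(6) by (rule S_primary_decomposition)
qed

end
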